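(* Let $i\ge0$ and let $K$ be a finite abstract simplicial complex having at least one $(i+1)$-face. If the chromatic number of the $1$-skeleton of $K$ is $i+2$, then $i+2$ is contained in the spectrum of $\Delta_i^{up}(K)$.
   Context: For a finite abstract simplicial complex $K$ (closed under inclusion, containing the empty face), $S_i(K)$ is the set of $i$-faces and $C^i(K,\mathbb{R})$ is the space of real functions on oriented $i$-faces that change sign when the orientation is reversed. The coboundary $\delta_i:C^i\to C^{i+1}$ is $(\delta_i f)([v_0,\dots,v_{i+1}])=\sum_{j}(-1)^j f([v_0,\dots,\hat v_j,\dots,v_{i+1}])$. A positive weight function $w$ on faces defines inner products $(f,g)_{C^i}=\sum_{F\in S_i(K)}w(F)f([F])g([F])$, with adjoint $\delta_i^*$. The degree of an $i$-face is $\deg F=\sum_{\bar F\in S_{i+1}(K),\,F\subset\bar F}w(\bar F)$. The normalized combinatorial Laplacian is $\Delta_i^{up}(K)=\delta_i^*\delta_i$ on $C^i(K,\mathbb{R})$ for the weight function with $w(F)=1$ for every facet (inclusion-maximal face) and $w(F)=\deg F$ for every other face. The $1$-skeleton is the graph of vertices and edges of $K$. *)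

theory Defs
  imports Complex_Main "HOL-Combinatorics.Permutations"
begin

definition finite_simplicial_complex :: "'a set set \<Rightarrow> bool" where
  "finite_simplicial_complex K \<longleftrightarrow>
     finite K \<and> {} \<in> K \<and> (\<forall>F\<in>K. finite F) \<and> (\<forall>F\<in>K. \<forall>G\<subseteq>F. G \<in> K)"

definition faces :: "'a set set \<Rightarrow> nat \<Rightarrow> 'a set set" where
  "faces K i = {F \<in> K. card F = i + 1}"

definition facet :: "'a set set \<Rightarrow> 'a set \<Rightarrow> bool" where
  "facet K F \<longleftrightarrow> F \<in> K \<and> (\<forall>G\<in>K. F \<subseteq> G \<longrightarrow> G = F)"

text \<open>Faces one dimension higher containing a given face. Cardinalities are used instead of
  dimensions so that the empty face, of dimension \<open>-1\<close>, is covered as well.\<close>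

definition cofaces :: "'a set set \<Rightarrow> 'a set \<Rightarrow> 'a set set" where
  "cofaces K F = {G \<in> K. F \<subset> G \<and> card G = card F + 1}"

definition face_degree :: "'a set set \<Rightarrow> ('a set \<Rightarrow> real) \<Rightarrow> 'a set \<Rightarrow> real" where
  "face_degree K w F = (\<Sum>G\<in>cofaces K F. w G)"

text \<open>The weight function of the normalized Laplacian is determined by downward recursion from
  the facets. The value \<open>1\<close> for infinite \<open>K\<close> only serves to make the function total; see
  \<open>normalized_weight_eq\<close> for the defining property.\<close>

function normalized_weight :: "'a set set \<Rightarrow> 'a set \<Rightarrow> real" where
  "normalized_weight K F =
     (if infinite K \<or> facet K F then 1 else (\<Sum>G\<in>cofaces K F. normalized_weight K G))"
  by pat_completeness auto
termination
proof (relation "measure (\<lambda>(K, F). card {H \<in> K. F \<subset> H})", goal_cases)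
  case 1
  then show ?case by simp
next
  case (2 K F G)
  then have "finite K" "G \<in> K" "F \<subset> G" by (auto simp: cofaces_def)
  then have "{H \<in> K. G \<subset> H} \<subset> {H \<in> K. F \<subset> H}" by blast
  then show ?case using \<open>finite K\<close> by (auto intro!: psubset_card_mono)
qed

declare normalized_weight.simps [simp del]

lemma normalized_weight_eq:
  assumes "finite K"
  shows "normalized_weight K F =
    (if facet K F then 1 else face_degree K (normalized_weight K) F)"
  using assms by (subst normalized_weight.simps) (simp add: face_degree_def)

text \<open>The oriented face \<open>[v\<^sub>0, \<dots>, v\<^sub>i]\<close> is represented by any of its orderings, a
  list of distinct vertices.\<close>

definition ordered_faces :: "'a set set \<Rightarrow> nat \<Rightarrow> 'a list set" where
  "ordered_faces K i = {vs. distinct vs \<and> set vs \<in> faces K i}"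

text \<open>Two orderings give the same orientation iff they differ by an even permutation. Hence a
  function on oriented faces that changes sign under reversal of orientation is an alternating
  function of the orderings. Cochains vanish outside the ordered faces, so that equality of
  cochains is equality of functions.\<close>

definition cochains :: "'a set set \<Rightarrow> nat \<Rightarrow> ('a list \<Rightarrow> real) set" where
  "cochains K i = {f.
     (\<forall>vs\<in>ordered_faces K i. \<forall>p. p permutes {..<length vs} \<longrightarrow>
        f (permute_list p vs) = of_int (sign p) * f vs) \<and>
     (\<forall>vs. vs \<notin> ordered_faces K i \<longrightarrow> f vs = 0)}"

definition coboundary ::
  "'a set set \<Rightarrow> nat \<Rightarrow> ('a list \<Rightarrow> real) \<Rightarrow> 'a list \<Rightarrow> real" where
  "coboundary K i f vs =
     (if vs \<in> ordered_faces K (i + 1)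
      then \<Sum>j\<le>i + 1. (-1) ^ j * f (take j vs @ drop (Suc j) vs)
      else 0)"

text \<open>An arbitrary orientation \<open>[F]\<close> of \<open>F\<close>. The inner product below does not
  depend on the choice, since both factors change sign together.\<close>

definition orient :: "'a set \<Rightarrow> 'a list" where
  "orient F = (SOME vs. distinct vs \<and> set vs = F)"

definition cochain_inner ::
  "'a set set \<Rightarrow> ('a set \<Rightarrow> real) \<Rightarrow> nat \<Rightarrow> ('a list \<Rightarrow> real) \<Rightarrow> ('a list \<Rightarrow> real) \<Rightarrow> real" where
  "cochain_inner K w i f g = (\<Sum>F\<in>faces K i. w F * f (orient F) * g (orient F))"

text \<open>The description is proper when \<open>K\<close> is finite and \<open>w\<close> is positive on its faces:
  the spaces are then finite-dimensional inner product spaces.\<close>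

definition coboundary_adjoint ::
  "'a set set \<Rightarrow> ('a set \<Rightarrow> real) \<Rightarrow> nat \<Rightarrow> ('a list \<Rightarrow> real) \<Rightarrow> 'a list \<Rightarrow> real" where
  "coboundary_adjoint K w i g =
     (THE h. h \<in> cochains K i \<and>
        (\<forall>f\<in>cochains K i. cochain_inner K w (i + 1) (coboundary K i f) g = cochain_inner K w i f h))"

definition up_laplacian ::
  "'a set set \<Rightarrow> ('a set \<Rightarrow> real) \<Rightarrow> nat \<Rightarrow> ('a list \<Rightarrow> real) \<Rightarrow> 'a list \<Rightarrow> real" where
  "up_laplacian K w i f = coboundary_adjoint K w i (coboundary K i f)"

definition normalized_up_laplacian ::
  "'a set set \<Rightarrow> nat \<Rightarrow> ('a list \<Rightarrow> real) \<Rightarrow> 'a list \<Rightarrow> real" where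
  "normalized_up_laplacian K = up_laplacian K (normalized_weight K)"

text \<open>The spectrum of an operator on the finite-dimensional space \<open>V\<close> of real functions is its
  set of eigenvalues. Only real eigenvalues are considered, which is no restriction for the
  self-adjoint operators at hand.\<close>

definition spectrum_on ::
  "('b \<Rightarrow> real) set \<Rightarrow> (('b \<Rightarrow> real) \<Rightarrow> 'b \<Rightarrow> real) \<Rightarrow> real set" where
  "spectrum_on V T = {\<mu>. \<exists>f\<in>V. f \<noteq> (\<lambda>_. 0) \<and> T f = (\<lambda>x. \<mu> * f x)}"

definition skeleton_vertices :: "'a set set \<Rightarrow> 'a set" where
  "skeleton_vertices K = {v. {v} \<in> K}"

definition skeleton_edges :: "'a set set \<Rightarrow> 'a set set" where
  "skeleton_edges K = {e \<in> K. card e = 2}"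

definition proper_colouring :: "'a set \<Rightarrow> 'a set set \<Rightarrow> nat \<Rightarrow> ('a \<Rightarrow> nat) \<Rightarrow> bool" where
  "proper_colouring V E k c \<longleftrightarrow>
     (\<forall>v\<in>V. c v < k) \<and> (\<forall>u v. u \<noteq> v \<and> {u, v} \<in> E \<longrightarrow> c u \<noteq> c v)"

definition chromatic_number :: "'a set \<Rightarrow> 'a set set \<Rightarrow> nat" where
  "chromatic_number V E = (LEAST k. \<exists>c. proper_colouring V E k c)"

end

(* Colour the vertices properly with the colours 0, ..., i+1. An (i+1)-face then carries every
   colour once, and an i-face that is not a facet misses exactly one colour. Let f send an ordered
   i-face to the sign of its list of colours followed by the missing one, and to 0 on facets.
   All i+2 terms of the coboundary of f on an (i+1)-face agree, so (delta f)(G) f(F) is i+2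
   times the incidence number [G:F] for every pair F < G, because f(F) = 1 or -1. Since
   the weight of a non-facet F is the sum of the weights of the faces G covering it,
   delta* delta f = (i+2) f. *)

theory Submission
  imports Defs
begin

section \<open>Signs of lists that enumerate an initial segment of the naturals\<close>

text \<open>The one-line notation of a permutation of \<open>{..<length xs}\<close>. Beyond the list
  it is the identity, as \<open>permutes\<close> demands.\<close>

definition list_perm :: "nat list \<Rightarrow> nat \<Rightarrow> nat" where
  "list_perm xs k = (if k < length xs then xs ! k else k)"

definition list_sign :: "nat list \<Rightarrow> real" where
  "list_sign xs = of_int (sign (list_perm xs))"

lemma list_perm_permutes:
  assumes "distinct xs" "set xs = {..<n}"
  shows "list_perm xs permutes {..<n}"
proof -
  have n: "length xs = n"
    using assms by (metis card_lessThan distinct_card)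
  have "bij_betw ((!) xs) {..<n} {..<n}"
    using assms n by (intro bij_betw_nth) auto
  then have "bij_betw (list_perm xs) {..<n} {..<n}"
    by (rule bij_betw_cong[THEN iffD1, rotated]) (simp add: list_perm_def n)
  then show ?thesis
    by (rule bij_imp_permutes) (simp add: list_perm_def n)
qed

text \<open>\<open>sign\<close> is multiplicative, and rearranging the positions of a list by
  \<open>p\<close> means composing with \<open>p\<close> on the right. Both reordering rules below
  reduce to this.\<close>

lemma list_sign_compose:
  assumes "distinct xs" "set xs = {..<n}" "p permutes {..<n}"
    and "list_perm ys = list_perm xs \<circ> p"
  shows "list_sign ys = of_int (sign p) * list_sign xs"
proof -
  have "permutation (list_perm xs)" "permutation p"
    using list_perm_permutes[OF assms(1,2)] assms(3)
    by (auto simp: permutation_permutes)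
  then show ?thesis
    by (simp add: list_sign_def assms(4) sign_compose)
qed

text \<open>As \<open>p\<close> fixes every position from \<open>length xs\<close> on, it acts on
  the whole list by the same permutation, with the same sign.\<close>

lemma list_sign_permute_append:
  assumes "distinct (xs @ zs)" "set (xs @ zs) = {..<n}" "p permutes {..<length xs}"
  shows "list_sign (permute_list p xs @ zs) = of_int (sign p) * list_sign (xs @ zs)"
proof (rule list_sign_compose[OF assms(1,2)])
  have "length (xs @ zs) = n"
    using assms(1,2) by (metis card_lessThan distinct_card)
  then show "p permutes {..<n}"
    by (intro permutes_subset[OF assms(3)]) auto
  have "p k < length xs" "p k < length xs + length zs" if "k < length xs" for k
    using permutes_in_image[OF assms(3), of k] that by simp_all
  moreover have "p k = k" if "\<not> k < length xs" for k
    using permutes_not_in[OF assms(3), of k] that by simp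
  ultimately show "list_perm (permute_list p xs @ zs) = list_perm (xs @ zs) \<circ> p"
    by (auto simp: list_perm_def fun_eq_iff nth_append permute_list_nth[OF assms(3)])
qed

lemma list_sign_swap:
  assumes "distinct (xs @ a # b # zs)" "set (xs @ a # b # zs) = {..<n}"
  shows "list_sign (xs @ b # a # zs) = - list_sign (xs @ a # b # zs)"
proof -
  let ?p = "transpose (length xs) (Suc (length xs))"
  have n: "length (xs @ a # b # zs) = n"
    using assms by (metis card_lessThan distinct_card)
  have "list_sign (xs @ b # a # zs) = of_int (sign ?p) * list_sign (xs @ a # b # zs)"
  proof (rule list_sign_compose[OF assms])
    show "?p permutes {..<n}"
      using n by (intro permutes_swap_id) auto
    show "list_perm (xs @ b # a # zs) = list_perm (xs @ a # b # zs) \<circ> ?p"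
      by (auto simp: list_perm_def fun_eq_iff nth_append nth_Cons transpose_def split: nat.splits)
  qed
  then show ?thesis
    by (simp add: sign_swap_id)
qed

text \<open>On its way to the end \<open>a\<close> passes each entry of \<open>zs\<close> once, by a
  swap of neighbours that costs one sign.\<close>

lemma list_sign_move_last:
  assumes "distinct (xs @ a # zs)" "set (xs @ a # zs) = {..<n}"
  shows "list_sign (xs @ zs @ [a]) = (-1) ^ length zs * list_sign (xs @ a # zs)"
  using assms
proof (induction zs arbitrary: xs)
  case (Cons z zs)
  \<comment> \<open>The prefix \<open>xs @ [z]\<close> describes the list after \<open>a\<close> has
    passed \<open>z\<close>; that one swap is paid for in the next step.\<close>
  have "list_sign (xs @ (z # zs) @ [a]) = (-1) ^ length zs * list_sign ((xs @ [z]) @ a # zs)"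
    using Cons.IH[of "xs @ [z]"] Cons.prems by (simp add: insert_commute)
  also have "list_sign ((xs @ [z]) @ a # zs) = - list_sign (xs @ a # z # zs)"
    using list_sign_swap[OF Cons.prems] by simp
  finally show ?case by simp
qed simp

lemma list_sign_nonzero: "list_sign xs \<noteq> 0"
  by (simp add: list_sign_def sign_def)

section \<open>Positivity of the normalized weight\<close>

lemma normalized_weight_nonfacet:
  assumes "finite K" "\<not> facet K F"
  shows "normalized_weight K F = (\<Sum>G\<in>cofaces K F. normalized_weight K G)"
  using normalized_weight_eq[OF assms(1), of F] assms(2) by (simp add: face_degree_def)

text \<open>One vertex of a strictly larger face is added to \<open>F\<close>; closure under
  inclusion keeps the result in \<open>K\<close>. Hence the sum that defines the weight of a
  non-facet is not empty.\<close>

lemma cofaces_nonempty: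
  assumes K: "finite_simplicial_complex K" and F: "F \<in> K" "\<not> facet K F"
  shows "cofaces K F \<noteq> {}"
proof -
  obtain H where H: "H \<in> K" "F \<subseteq> H" "H \<noteq> F"
    using F by (auto simp: facet_def)
  then obtain x where "x \<in> H" "x \<notin> F" by blast
  moreover have "finite F" using K F by (auto simp: finite_simplicial_complex_def)
  moreover have "insert x F \<in> K"
    using K H \<open>x \<in> H\<close> by (auto simp: finite_simplicial_complex_def)
  ultimately have "insert x F \<in> cofaces K F"
    by (auto simp: cofaces_def)
  then show ?thesis by blast
qed

text \<open>Induction downwards from the facets: a coface of \<open>F\<close> has fewer faces
  strictly above it than \<open>F\<close> has.\<close>

lemma normalized_weight_pos:
  assumes K: "finite_simplicial_complex K"
  shows "F \<in> K \<Longrightarrow> normalized_weight K F > 0"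
proof (induction "card {H \<in> K. F \<subset> H}" arbitrary: F rule: less_induct)
  case less
  have fin: "finite K" using K by (simp add: finite_simplicial_complex_def)
  show ?case
  proof (cases "facet K F")
    case True
    then show ?thesis using fin by (simp add: normalized_weight_eq)
  next
    case False
    have "normalized_weight K G > 0" if "G \<in> cofaces K F" for G
    proof (rule less.hyps)
      have G: "G \<in> K" "F \<subset> G" using that by (auto simp: cofaces_def)
      then have "{H \<in> K. G \<subset> H} \<subset> {H \<in> K. F \<subset> H}" by blast
      then show "card {H \<in> K. G \<subset> H} < card {H \<in> K. F \<subset> H}"
        using fin by (auto intro!: psubset_card_mono)
      show "G \<in> K" by fact
    qed
    moreover have "finite (cofaces K F)" using fin by (simp add: cofaces_def)
    ultimately show ?thesis
      using cofaces_nonempty[OF K less.prems False] False fin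
      by (auto simp: normalized_weight_nonfacet intro!: sum_pos)
  qed
qed

section \<open>Cochains, their inner product and uniqueness of the adjoint\<close>

lemma orient:
  assumes "finite F"
  shows "distinct (orient F)" "set (orient F) = F"
  using someI_ex[of "\<lambda>vs. distinct vs \<and> set vs = F"] finite_distinct_list[OF assms]
  by (auto simp: orient_def)

lemma finite_face:
  assumes "finite_simplicial_complex K" "F \<in> faces K i"
  shows "finite F"
  using assms by (auto simp: finite_simplicial_complex_def faces_def)

lemma orient_in_ordered_faces:
  assumes "finite_simplicial_complex K" "F \<in> faces K i"
  shows "orient F \<in> ordered_faces K i"
  using orient[OF finite_face[OF assms]] assms by (auto simp: ordered_faces_def)

text \<open>The sign \<open>s\<close> depends only on the two orderings, so one \<open>s\<close>
  serves all cochains at once; in a product of two cochains it cancels.\<close>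

lemma cochains_reorder:
  assumes vs: "vs \<in> ordered_faces K i" and ws: "distinct ws" "set ws = set vs"
  obtains s :: real where "s * s = 1" "\<And>f. f \<in> cochains K i \<Longrightarrow> f ws = s * f vs"
proof -
  have "mset ws = mset vs"
    using ws vs by (metis (no_types, lifting) mem_Collect_eq ordered_faces_def set_eq_iff_mset_eq_distinct)
  then obtain p where p: "p permutes {..<length vs}" "permute_list p vs = ws"
    by (metis mset_eq_permutation)
  show ?thesis
  proof (rule that[of "of_int (sign p)"])
    show "of_int (sign p) * of_int (sign p) = (1 :: real)"
      by (simp add: sign_def)
    show "f ws = of_int (sign p) * f vs" if "f \<in> cochains K i" for f
      using that p vs by (auto simp: cochains_def)
  qed
qed

lemma cochains_mult_reorder:
  assumes "f \<in> cochains K i" "g \<in> cochains K i"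
    and "vs \<in> ordered_faces K i" "distinct ws" "set ws = set vs"
  shows "f ws * g ws = f vs * g vs"
proof -
  obtain s :: real where s: "s * s = 1" "\<And>f. f \<in> cochains K i \<Longrightarrow> f ws = s * f vs"
    using cochains_reorder[OF assms(3-5)] by metis
  have "f ws * g ws = (s * s) * (f vs * g vs)"
    using s(2)[OF assms(1)] s(2)[OF assms(2)] by simp
  then show ?thesis using s(1) by simp
qed

lemma cochains_diff:
  "f \<in> cochains K i \<Longrightarrow> g \<in> cochains K i \<Longrightarrow> (\<lambda>vs. f vs - g vs) \<in> cochains K i"
  by (auto simp: cochains_def algebra_simps)

lemma cochains_scale:
  "f \<in> cochains K i \<Longrightarrow> (\<lambda>vs. r * f vs) \<in> cochains K i"
  by (auto simp: cochains_def)

text \<open>A vanishing sum of nonnegative terms forces \<open>f\<close> to vanish on each chosen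
  orientation. Since squares do not depend on the ordering, \<open>f\<close> then vanishes on every
  ordering.\<close>

lemma cochain_inner_definite:
  assumes K: "finite_simplicial_complex K" and w: "\<And>F. F \<in> K \<Longrightarrow> w F > 0"
    and f: "f \<in> cochains K i" and zero: "cochain_inner K w i f f = 0"
  shows "f vs = 0"
proof (cases "vs \<in> ordered_faces K i")
  case True
  define F where "F = set vs"
  have F: "F \<in> faces K i" and d: "distinct vs"
    using True by (auto simp: F_def ordered_faces_def)
  have fin: "finite (faces K i)"
    using K by (simp add: finite_simplicial_complex_def faces_def)
  have "w G * f (orient G) * f (orient G) \<ge> 0" if "G \<in> faces K i" for G
    using w[of G] that by (auto simp: faces_def mult.assoc)
  then have "w F * f (orient F) * f (orient F) = 0"
    using zero F fin by (simp add: cochain_inner_def sum_nonneg_eq_0_iff)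
  moreover have "w F > 0" using w F by (auto simp: faces_def)
  ultimately have "f (orient F) * f (orient F) = 0" by simp
  moreover have "f vs * f vs = f (orient F) * f (orient F)"
    using orient(2)[OF finite_face[OF K F]] d
    by (intro cochains_mult_reorder[OF f f orient_in_ordered_faces[OF K F]]) (auto simp: F_def)
  ultimately show ?thesis by simp
qed (use f in \<open>auto simp: cochains_def\<close>)

text \<open>Resolves the \<open>THE\<close> in the definition of the adjoint: two candidates have
  the same inner product with every cochain, in particular with their difference \<open>d\<close>,
  so definiteness gives \<open>d = 0\<close>.\<close>

lemma coboundary_adjoint_eqI:
  assumes K: "finite_simplicial_complex K" and w: "\<And>F. F \<in> K \<Longrightarrow> w F > 0"
    and h: "h \<in> cochains K i"
    and adj: "\<And>f. f \<in> cochains K i \<Longrightarrow>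
      cochain_inner K w (i + 1) (coboundary K i f) g = cochain_inner K w i f h"
  shows "coboundary_adjoint K w i g = h"
  unfolding coboundary_adjoint_def
proof (rule the_equality)
  fix h'
  assume h': "h' \<in> cochains K i \<and> (\<forall>f\<in>cochains K i.
    cochain_inner K w (i + 1) (coboundary K i f) g = cochain_inner K w i f h')"
  define d where "d vs = h' vs - h vs" for vs
  have d: "d \<in> cochains K i"
    using cochains_diff[of h' K i h] h h' unfolding d_def[abs_def] by blast
  have "cochain_inner K w i d d = cochain_inner K w i d h' - cochain_inner K w i d h"
    by (simp add: cochain_inner_def d_def algebra_simps flip: sum_subtractf)
  also have "\<dots> = 0" using h' adj d by fastforce
  finally have "d vs = 0" for vs
    by (intro cochain_inner_definite[of K w d i] K w d)
  then show "h' = h" by (simp add: d_def fun_eq_iff)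
qed (use h adj in auto)

section \<open>Proper colourings and the colour cochain\<close>

text \<open>By closure under inclusion any two vertices of a face span an edge, so a face is a
  clique of the 1-skeleton.\<close>

lemma proper_colouring_face:
  assumes K: "finite_simplicial_complex K"
    and c: "proper_colouring (skeleton_vertices K) (skeleton_edges K) n c"
    and F: "F \<in> K"
  shows "inj_on c F" "c ` F \<subseteq> {..<n}"
proof -
  have sub: "G \<in> K" if "G \<subseteq> F" for G
    using K F that by (auto simp: finite_simplicial_complex_def)
  show "inj_on c F"
  proof (rule inj_onI, rule ccontr)
    fix u v assume uv: "u \<in> F" "v \<in> F" "c u = c v" "u \<noteq> v"
    then have "{u, v} \<in> skeleton_edges K"
      using sub[of "{u, v}"] by (auto simp: skeleton_edges_def)
    then show False using c uv by (auto simp: proper_colouring_def)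
  qed
  show "c ` F \<subseteq> {..<n}"
    using c sub by (auto simp: proper_colouring_def skeleton_vertices_def)
qed

text \<open>The \<open>LEAST\<close> is attained because some colouring exists: an injective
  numbering of the finite vertex set.\<close>

lemma chromatic_number_colouring:
  assumes "finite V" "\<Union>E \<subseteq> V"
  obtains c where "proper_colouring V E (chromatic_number V E) c"
proof -
  obtain c :: "'a \<Rightarrow> nat" and n where c: "c ` V = {i. i < n}" "inj_on c V"
    using finite_imp_inj_to_nat_seg[OF assms(1)] by blast
  have "proper_colouring V E n c"
    unfolding proper_colouring_def
  proof (intro conjI ballI allI impI)
    show "c v < n" if "v \<in> V" for v using c(1) that by blast
    show "c u \<noteq> c v" if "u \<noteq> v \<and> {u, v} \<in> E" for u v
      using that assms(2) c(2) by (auto dest: inj_onD)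
  qed
  then have "\<exists>c. proper_colouring V E (chromatic_number V E) c"
    unfolding chromatic_number_def by (intro LeastI[of "\<lambda>k. \<exists>c. proper_colouring V E k c"]) blast
  then show ?thesis using that by blast
qed

text \<open>The missing colour comes last, not first, so that a reordering of the face acts on the
  positions of the extended list by the same permutation. The value on facets must be \<open>0\<close>
  because facets lie in the kernel of the up-Laplacian.\<close>

definition colour_cochain :: "'a set set \<Rightarrow> nat \<Rightarrow> ('a \<Rightarrow> nat) \<Rightarrow> 'a list \<Rightarrow> real" where
  "colour_cochain K i c vs =
     (if vs \<in> ordered_faces K i \<and> \<not> facet K (set vs)
      then list_sign (map c vs @ [the_elem ({..<i + 2} - c ` set vs)]) else 0)"

text \<open>The \<open>i + 1\<close> vertices have distinct colours among \<open>i + 2\<close>,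
  which leaves exactly one.\<close>

lemma missing_colour:
  assumes K: "finite_simplicial_complex K"
    and c: "proper_colouring (skeleton_vertices K) (skeleton_edges K) (i + 2) c"
    and vs: "vs \<in> ordered_faces K i"
  obtains m where "{..<i + 2} - c ` set vs = {m}"
    "distinct (map c vs @ [m])" "set (map c vs @ [m]) = {..<i + 2}"
proof -
  have F: "set vs \<in> K" "card (set vs) = i + 1" "distinct vs"
    using vs by (auto simp: ordered_faces_def faces_def)
  note col = proper_colouring_face[OF K c F(1)]
  have "card ({..<i + 2} - c ` set vs) = 1"
    using col F(2) by (simp add: card_Diff_subset card_image)
  then obtain m where m: "{..<i + 2} - c ` set vs = {m}"
    by (auto simp: card_1_singleton_iff)
  show ?thesis
  proof (rule that[OF m])
    show "distinct (map c vs @ [m])"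
      using m col F by (auto simp: distinct_map)
    show "set (map c vs @ [m]) = {..<i + 2}"
      using m col(2) by auto
  qed
qed

text \<open>Reordering keeps the vertex set, hence also the facet test and the missing colour
  \<open>m\<close>. Only the part of the list before \<open>m\<close> is permuted.\<close>

lemma colour_cochain_in_cochains:
  assumes K: "finite_simplicial_complex K"
    and c: "proper_colouring (skeleton_vertices K) (skeleton_edges K) (i + 2) c"
  shows "colour_cochain K i c \<in> cochains K i"
  unfolding cochains_def
proof (intro CollectI conjI ballI allI impI)
  fix vs p assume vs: "vs \<in> ordered_faces K i" and p: "p permutes {..<length vs}"
  obtain m where m: "{..<i + 2} - c ` set vs = {m}"
    "distinct (map c vs @ [m])" "set (map c vs @ [m]) = {..<i + 2}"
    using missing_colour[OF K c vs] .
  have set: "set (permute_list p vs) = set vs"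
    using p by (rule set_permute_list)
  have "permute_list p vs \<in> ordered_faces K i"
    using vs p set by (simp add: ordered_faces_def distinct_permute_list)
  moreover have "list_sign (permute_list p (map c vs) @ [m])
      = of_int (sign p) * list_sign (map c vs @ [m])"
    using p by (intro list_sign_permute_append[OF m(2,3)]) simp
  ultimately show "colour_cochain K i c (permute_list p vs) = of_int (sign p) * colour_cochain K i c vs"
    using vs p unfolding colour_cochain_def set m(1) the_elem_eq
    by (simp add: permute_list_map)
qed (simp add: colour_cochain_def)

section \<open>Vertex deletion and the coboundary of the colour cochain\<close>

text \<open>What remains after a deletion lies strictly inside \<open>set vs\<close>, so it is no
  facet and the default value 0 of the colour cochain does not occur there.\<close>

lemma ordered_faces_delete:
  assumes K: "finite_simplicial_complex K"
    and vs: "vs \<in> ordered_faces K (i + 1)" and j: "j \<le> i + 1"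
  shows "take j vs @ drop (Suc j) vs \<in> ordered_faces K i"
    and "set (take j vs @ drop (Suc j) vs) = set vs - {vs ! j}"
    and "\<not> facet K (set vs - {vs ! j})"
    and "vs = take j vs @ vs ! j # drop (Suc j) vs"
    and "vs ! j \<in> set vs"
proof -
  have d: "distinct vs" and F: "set vs \<in> K" "card (set vs) = i + 2"
    using vs by (auto simp: ordered_faces_def faces_def)
  have len: "length vs = i + 2" using d F by (simp add: distinct_card)
  show split: "vs = take j vs @ vs ! j # drop (Suc j) vs"
    using j len by (simp add: id_take_nth_drop)
  show mem: "vs ! j \<in> set vs" using j len by simp
  have "distinct (take j vs @ vs ! j # drop (Suc j) vs)" using d split by simp
  then have d': "distinct (take j vs @ drop (Suc j) vs)"
    and nin: "vs ! j \<notin> set (take j vs @ drop (Suc j) vs)" by auto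
  have "set vs = insert (vs ! j) (set (take j vs @ drop (Suc j) vs))"
    by (subst split) simp
  then show set: "set (take j vs @ drop (Suc j) vs) = set vs - {vs ! j}"
    using nin by auto
  have "set vs - {vs ! j} \<in> K" using K F by (auto simp: finite_simplicial_complex_def)
  then show "take j vs @ drop (Suc j) vs \<in> ordered_faces K i"
    using d' set F mem by (simp add: ordered_faces_def faces_def)
  show "\<not> facet K (set vs - {vs ! j})"
    using F mem by (auto simp: facet_def)
qed

text \<open>An \<open>(i+1)\<close>-face carries all \<open>i + 2\<close> colours, so deleting
  vertex \<open>j\<close> makes exactly its colour the missing one. Between position
  \<open>j\<close> and the end this colour passes \<open>i + 1 - j\<close> entries.\<close>

lemma colour_cochain_delete:
  assumes K: "finite_simplicial_complex K"
    and c: "proper_colouring (skeleton_vertices K) (skeleton_edges K) (i + 2) c"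
    and vs: "vs \<in> ordered_faces K (i + 1)" and j: "j \<le> i + 1"
  shows "colour_cochain K i c (take j vs @ drop (Suc j) vs)
    = (-1) ^ (i + 1 - j) * list_sign (map c vs)"
proof -
  have d: "distinct vs" and F: "set vs \<in> K" "card (set vs) = i + 2"
    using vs by (auto simp: ordered_faces_def faces_def)
  have len: "length vs = i + 2" using d F by (simp add: distinct_card)
  note col = proper_colouring_face[OF K c F(1)]
  note del = ordered_faces_delete[OF K vs j]
  have im: "c ` set vs = {..<i + 2}"
    using col F by (intro card_subset_eq) (auto simp: card_image)
  have split: "map c vs = map c (take j vs) @ c (vs ! j) # map c (drop (Suc j) vs)"
    by (subst del(4)) simp
  have "{..<i + 2} - c ` (set vs - {vs ! j}) = {c (vs ! j)}"
    using col(1) del(5) im[symmetric] by (auto simp: inj_on_def)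
  then have "colour_cochain K i c (take j vs @ drop (Suc j) vs)
      = list_sign (map c (take j vs) @ map c (drop (Suc j) vs) @ [c (vs ! j)])"
    using del(1,3) unfolding colour_cochain_def del(2) by simp
  also have "\<dots> = (-1) ^ length (map c (drop (Suc j) vs)) * list_sign (map c vs)"
    unfolding split
  proof (rule list_sign_move_last)
    show "distinct (map c (take j vs) @ c (vs ! j) # map c (drop (Suc j) vs))"
      unfolding split[symmetric] using d col(1) by (simp add: distinct_map)
    show "set (map c (take j vs) @ c (vs ! j) # map c (drop (Suc j) vs)) = {..<i + 2}"
      unfolding split[symmetric] using im by simp
  qed
  finally show ?thesis using len by simp
qed

text \<open>The signs \<open>(-1) ^ l\<close> and \<open>(-1) ^ (i + 1 - l)\<close> combine to
  \<open>(-1) ^ (i + 1)\<close>, so all \<open>i + 2\<close> terms agree. The result is stated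
  through the term at an arbitrary \<open>j\<close>, to be paired with the term of another
  coboundary at the same \<open>j\<close>.\<close>

lemma coboundary_colour_cochain:
  assumes K: "finite_simplicial_complex K"
    and c: "proper_colouring (skeleton_vertices K) (skeleton_edges K) (i + 2) c"
    and vs: "vs \<in> ordered_faces K (i + 1)" and j: "j \<le> i + 1"
  shows "coboundary K i (colour_cochain K i c) vs
    = real (i + 2) * ((-1) ^ j * colour_cochain K i c (take j vs @ drop (Suc j) vs))"
proof -
  have *: "(-1) ^ l * colour_cochain K i c (take l vs @ drop (Suc l) vs)
      = (-1) ^ (i + 1) * list_sign (map c vs)" if "l \<le> i + 1" for l
  proof -
    have "(-1) ^ l * (-1) ^ (i + 1 - l) = (-1 :: real) ^ (i + 1)"
      using that by (simp flip: power_add)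
    then show ?thesis
      unfolding colour_cochain_delete[OF K c vs that] by (metis mult.assoc)
  qed
  have "coboundary K i (colour_cochain K i c) vs
      = (\<Sum>l\<le>i + 1. (-1) ^ (i + 1) * list_sign (map c vs))"
    unfolding coboundary_def using vs * by (auto intro!: sum.cong)
  also have "\<dots> = real (i + 2) * ((-1) ^ (i + 1) * list_sign (map c vs))"
    by (simp add: algebra_simps)
  finally show ?thesis unfolding *[OF j] .
qed

text \<open>Expanding only the coboundary of \<open>f\<close> leaves one sum over the vertices of
  \<open>G\<close>, that is, over its \<open>i\<close>-faces. In each term the other coboundary is
  written with the same index.\<close>

lemma coboundary_inner_colour_cochain:
  assumes K: "finite_simplicial_complex K"
    and c: "proper_colouring (skeleton_vertices K) (skeleton_edges K) (i + 2) c"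
    and f: "f \<in> cochains K i" and G: "G \<in> faces K (i + 1)"
  shows "coboundary K i f (orient G) * coboundary K i (colour_cochain K i c) (orient G)
    = real (i + 2) * (\<Sum>F\<in>{F \<in> faces K i. G \<in> cofaces K F}.
        f (orient F) * colour_cochain K i c (orient F))"
proof -
  define vs where "vs = orient G"
  define g where "g = colour_cochain K i c"
  have vs: "vs \<in> ordered_faces K (i + 1)"
    unfolding vs_def by (rule orient_in_ordered_faces[OF K G])
  have d: "distinct vs" "set vs = G" using orient[OF finite_face[OF K G]] by (simp_all add: vs_def)
  have cG: "card G = i + 2" "G \<in> K" using G by (auto simp: faces_def)
  have len: "length vs = i + 2" using d cG by (metis distinct_card)
  have g: "g \<in> cochains K i" unfolding g_def by (rule colour_cochain_in_cochains[OF K c])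
  note del = ordered_faces_delete[OF K vs, unfolded d(2)]
  have bij: "bij_betw (\<lambda>j. G - {vs ! j}) {..i + 1} {F \<in> faces K i. G \<in> cofaces K F}"
    unfolding bij_betw_def
  proof
    show "inj_on (\<lambda>j. G - {vs ! j}) {..i + 1}"
    proof (rule inj_onI)
      fix j l assume jl: "j \<in> {..i + 1}" "l \<in> {..i + 1}" "G - {vs ! j} = G - {vs ! l}"
      then have "vs ! j = vs ! l" using del(5)[of j] del(5)[of l] by auto
      then show "j = l" using d(1) len jl by (simp add: nth_eq_iff_index_eq)
    qed
    show "(\<lambda>j. G - {vs ! j}) ` {..i + 1} = {F \<in> faces K i. G \<in> cofaces K F}"
    proof (intro equalityI subsetI)
      fix F assume "F \<in> (\<lambda>j. G - {vs ! j}) ` {..i + 1}"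
      then obtain j where j: "j \<le> i + 1" "F = G - {vs ! j}" by auto
      have "F \<in> faces K i" using del(1,2)[OF j(1)] j(2) by (simp add: ordered_faces_def)
      then show "F \<in> {F \<in> faces K i. G \<in> cofaces K F}"
        using del(5)[OF j(1)] j(2) cG by (auto simp: cofaces_def faces_def)
    next
      \<comment> \<open>Surjectivity: \<open>F\<close> lacks a single vertex of \<open>G\<close>,
        and its position in \<open>vs\<close> is the index sought.\<close>
      fix F assume "F \<in> {F \<in> faces K i. G \<in> cofaces K F}"
      then have F: "F \<subset> G" "card F = i + 1" by (auto simp: faces_def cofaces_def)
      have finG: "finite G" using d by auto
      then have "card (G - F) = 1"
        using F cG card_Diff_subset[of F G] finite_subset[of F G] by auto
      then obtain v where v: "G - F = {v}" by (auto simp: card_1_singleton_iff)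
      then have "v \<in> set vs" using d by auto
      then obtain j where j: "j < length vs" "vs ! j = v" by (auto simp: in_set_conv_nth)
      have "F = G - {vs ! j}" using v F j(2) by auto
      then show "F \<in> (\<lambda>j. G - {vs ! j}) ` {..i + 1}" using j(1) len by auto
    qed
  qed
  have "coboundary K i f vs * coboundary K i g vs
      = (\<Sum>j\<le>i + 1. (-1) ^ j * f (take j vs @ drop (Suc j) vs) * coboundary K i g vs)"
    unfolding coboundary_def[of K i f] if_P[OF vs] by (rule sum_distrib_right)
  also have "\<dots> = (\<Sum>j\<le>i + 1. real (i + 2) * (f (orient (G - {vs ! j})) * g (orient (G - {vs ! j}))))"
  proof (rule sum.cong[OF refl])
    fix j assume "j \<in> {..i + 1}"
    then have j: "j \<le> i + 1" by simp
    let ?us = "take j vs @ drop (Suc j) vs"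
    have fin: "finite (G - {vs ! j})" using d(2) by auto
    have sq: "(-1) ^ j * (-1) ^ j = (1 :: real)" by (simp flip: power_mult_distrib)
    \<comment> \<open>Both incidence signs are \<open>(-1) ^ j\<close>, so their product is 1. What
      is left is a product of two cochains, which may be evaluated on the chosen
      orientation.\<close>
    have "(-1) ^ j * f ?us * coboundary K i g vs
        = ((-1) ^ j * (-1) ^ j) * (real (i + 2) * (f ?us * g ?us))"
      unfolding g_def coboundary_colour_cochain[OF K c vs j] by (simp only: ac_simps)
    also have "f ?us * g ?us = f (orient (G - {vs ! j})) * g (orient (G - {vs ! j}))"
      using orient[OF fin] del(2)[OF j]
      by (intro cochains_mult_reorder[OF f g del(1)[OF j], symmetric]) auto
    finally show "(-1) ^ j * f ?us * coboundary K i g vs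
        = real (i + 2) * (f (orient (G - {vs ! j})) * g (orient (G - {vs ! j})))"
      using sq by simp
  qed
  also have "\<dots> = (\<Sum>F\<in>{F \<in> faces K i. G \<in> cofaces K F}. real (i + 2) * (f (orient F) * g (orient F)))"
    by (rule sum.reindex_bij_betw[OF bij])
  finally show ?thesis
    by (simp only: vs_def g_def sum_distrib_left)
qed

section \<open>The eigenvalue equation\<close>

text \<open>This is the weak form of the eigenvalue equation. Exchanging the sums over
  \<open>G\<close> and \<open>F\<close> collects at each \<open>F\<close> the weights of its
  cofaces, whose sum is the weight of \<open>F\<close> unless \<open>F\<close> is a facet.\<close>

lemma cochain_inner_coboundary_colour_cochain:
  assumes K: "finite_simplicial_complex K"
    and c: "proper_colouring (skeleton_vertices K) (skeleton_edges K) (i + 2) c"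
    and f: "f \<in> cochains K i"
  shows "cochain_inner K (normalized_weight K) (i + 1)
      (coboundary K i f) (coboundary K i (colour_cochain K i c))
    = cochain_inner K (normalized_weight K) i f (\<lambda>vs. real (i + 2) * colour_cochain K i c vs)"
proof -
  define g where "g = colour_cochain K i c"
  define w where "w = normalized_weight K"
  define a where "a F = real (i + 2) * (f (orient F) * g (orient F))" for F
  have finK: "finite K" using K by (simp add: finite_simplicial_complex_def)
  then have fin: "finite (faces K l)" for l by (simp add: faces_def)
  have cof: "{G \<in> faces K (i + 1). G \<in> cofaces K F} = cofaces K F" if "F \<in> faces K i" for F
    using that by (auto simp: faces_def cofaces_def)
  \<comment> \<open>On a facet the sum is empty while \<open>w F\<close> is 1; the equation survives
    because the colour cochain, and with it \<open>a F\<close>, is 0 there.\<close>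
  have weight: "(\<Sum>G\<in>cofaces K F. w G) * a F = w F * a F" if F: "F \<in> faces K i" for F
  proof (cases "facet K F")
    case True
    then have "a F = 0"
      using orient[OF finite_face[OF K F]] by (simp add: a_def g_def colour_cochain_def)
    then show ?thesis by simp
  next
    case False
    then show ?thesis using normalized_weight_nonfacet[OF finK False] by (simp add: w_def)
  qed
  have "cochain_inner K w (i + 1) (coboundary K i f) (coboundary K i g)
      = (\<Sum>G\<in>faces K (i + 1). \<Sum>F\<in>{F \<in> faces K i. G \<in> cofaces K F}. w G * a F)"
    unfolding cochain_inner_def
    by (rule sum.cong)
      (simp_all add: mult.assoc coboundary_inner_colour_cochain[OF K c f] g_def a_def sum_distrib_left)
  also have "\<dots> = (\<Sum>F\<in>faces K i. \<Sum>G\<in>{G \<in> faces K (i + 1). G \<in> cofaces K F}. w G * a F)"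
    by (rule sum.swap_restrict[OF fin fin])
  also have "\<dots> = (\<Sum>F\<in>faces K i. w F * a F)"
    by (rule sum.cong) (simp_all only: cof weight flip: sum_distrib_right)
  also have "\<dots> = cochain_inner K w i f (\<lambda>vs. real (i + 2) * g vs)"
    unfolding cochain_inner_def a_def by (rule sum.cong) (simp_all only: ac_simps)
  finally show ?thesis unfolding w_def g_def .
qed

theorem theorem7p3:
  fixes K :: "'a set set" and i :: nat
  assumes "finite_simplicial_complex K"
    and "faces K (i + 1) \<noteq> {}"
    and "chromatic_number (skeleton_vertices K) (skeleton_edges K) = i + 2"
  shows "real (i + 2) \<in> spectrum_on (cochains K i) (normalized_up_laplacian K i)"
proof -
  note K = assms(1)
  have "finite (skeleton_vertices K)"
  proof (rule finite_subset)
    show "skeleton_vertices K \<subseteq> \<Union>K" by (auto simp: skeleton_vertices_def)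
    show "finite (\<Union>K)" using K by (auto simp: finite_simplicial_complex_def)
  qed
  moreover have "\<Union>(skeleton_edges K) \<subseteq> skeleton_vertices K"
    using K unfolding finite_simplicial_complex_def skeleton_edges_def skeleton_vertices_def by blast
  ultimately obtain c
    where c: "proper_colouring (skeleton_vertices K) (skeleton_edges K) (i + 2) c"
    using chromatic_number_colouring assms(3) by metis
  let ?f = "colour_cochain K i c"
  have f: "?f \<in> cochains K i" by (rule colour_cochain_in_cochains[OF K c])
  obtain G where G: "G \<in> faces K (i + 1)" using assms(2) by blast
  \<comment> \<open>Removing the first vertex of an \<open>(i+1)\<close>-face gives an
    \<open>i\<close>-face that is not a facet, where the value of \<open>?f\<close> is a
    sign.\<close>
  have "?f (take 0 (orient G) @ drop (Suc 0) (orient G)) \<noteq> 0"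
    by (subst colour_cochain_delete[OF K c orient_in_ordered_faces[OF K G]])
      (simp_all add: list_sign_nonzero)
  then have "?f \<noteq> (\<lambda>_. 0)" by metis
  \<comment> \<open>The multiple of \<open>?f\<close> by \<open>i + 2\<close> satisfies the defining
    property of the adjoint at the coboundary of \<open>?f\<close>, and positive weights make it the
    only such cochain.\<close>
  moreover have "normalized_up_laplacian K i ?f = (\<lambda>vs. real (i + 2) * ?f vs)"
    unfolding normalized_up_laplacian_def up_laplacian_def
    by (rule coboundary_adjoint_eqI[OF K normalized_weight_pos[OF K] cochains_scale[OF f]
      cochain_inner_coboundary_colour_cochain[OF K c]])
  ultimately show ?thesis
    using f unfolding spectrum_on_def by blast
qed

end
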